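(* Fix an integer $k\geq 3$ and a prime $p\geq 5$. There is a constant $C_k'$ depending only on $k$ such that the following holds. For any positive integer $n$, let $(x_{1,i}, x_{2,i}, \dots, x_{k,i})_{i=1}^L$ be a collection of $k$-tuples of elements of $\mathbb{F}_p^{n}$ such that for each $j=1,\dots,k$ the elements $x_{j,i}$, $i\in\{1,\dots,L\}$, are distinct, such that $x_{1,i}+x_{2,i}+\dots+x_{k,i}=0$ for every $i=1,\dots,L$, and such that there are no distinct indices $i_1,\dots,i_k\in\{1,\dots,L\}$ with $x_{1,i_1}+x_{2,i_2}+\dots+x_{k,i_k}=0$. Then \[L\leq C_k'\cdot\left(\sqrt{\Gamma_{p,k}\cdot p}\right)^n.\]
   Context: $\Gamma_{p,k}=\min_{0<t<1}\frac{1+t+\dots+t^{p-1}}{t^{(p-1)/k}}$. *)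

theory Defs
  imports Complex_Main "HOL-Number_Theory.Residues" "HOL-Algebra.Product_Groups"
begin

text \<open>The real exponent \<open>(p - 1) / k\<close> need not be an integer, hence \<open>powr\<close>.\<close>

definition Gamma_fun :: "nat \<Rightarrow> nat \<Rightarrow> real \<Rightarrow> real" where
  "Gamma_fun p k t = (\<Sum>i<p. t ^ i) / t powr ((real p - 1) / real k)"

text \<open>\<open>LEAST\<close> is the minimum of the set of values; by \<open>Gamma_min_attained\<close> below it
  exists for all \<open>p \<ge> 2\<close> and \<open>k \<ge> 3\<close>.\<close>

definition Gamma_min :: "nat \<Rightarrow> nat \<Rightarrow> real" where
  "Gamma_min p k = (LEAST y. y \<in> Gamma_fun p k ` {0<..<1})"

text \<open>The additive group of \<open>\<F>\<^sub>p\<^sup>n\<close>, written multiplicatively: vectors are extensional functions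
  on \<open>{..<n}\<close> with values in the residue ring \<open>{0..p - 1}\<close>, and the group operation is
  coordinatewise addition modulo \<open>p\<close>.\<close>

definition Fp_space :: "nat \<Rightarrow> nat \<Rightarrow> (nat \<Rightarrow> int) monoid" where
  "Fp_space p n = product_group {..<n} (\<lambda>_. add_monoid (residue_ring (int p)))"

lemma Gamma_min_attained:
  assumes p: "p \<ge> 2" and k: "k \<ge> 3"
  obtains t where "0 < t" "t < 1" "Gamma_min p k = Gamma_fun p k t"
    "\<And>s. 0 < s \<Longrightarrow> s < 1 \<Longrightarrow> Gamma_fun p k t \<le> Gamma_fun p k s"
proof -
  define a where "a = (real p - 1) / real k"
  have a0: "a > 0" using p k by (simp add: a_def)
  have a2: "2 * a < real p - 1"
  proof -
    have "(real p - 1) * 2 < (real p - 1) * real k"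
      using p k by (intro mult_strict_left_mono) auto
    then show ?thesis using k by (simp add: a_def field_simps)
  qed
  define f where "f = Gamma_fun p k"
  have f: "f t = (\<Sum>i<p. t ^ i) / t powr a" for t
    by (simp add: f_def Gamma_fun_def a_def)
  have f1: "f 1 = real p" by (simp add: f)
  have deriv: "(f has_real_derivative
      ((\<Sum>i<p. real i * t ^ (i - 1)) * t powr a - (\<Sum>i<p. t ^ i) * (a * t powr (a - 1)))
        / (t powr a * t powr a)) (at t)" if "t > 0" for t
    unfolding f[abs_def] using that
    by (auto intro!: derivative_eq_intros DERIV_powr sum.cong simp: mult_ac)
  have sumi: "(\<Sum>i<p. real i) = real p * (real p - 1) / 2"
    by (induction p) (auto simp: field_simps)
  have d1: "(\<Sum>i<p. real i) - real p * a > 0"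
  proof -
    have "real p * (2 * a) < real p * (real p - 1)"
      using a2 p by (intro mult_strict_left_mono) auto
    then show ?thesis by (simp add: sumi)
  qed
  have "(f has_real_derivative (\<Sum>i<p. real i) - real p * a) (at 1)"
    using deriv[of 1] by simp
  then obtain d where d: "d > 0" "\<And>h. 0 < h \<Longrightarrow> h < d \<Longrightarrow> f (1 - h) < f 1"
    using DERIV_pos_inc_left[OF _ d1] by blast
  define s0 where "s0 = 1 - min (d / 2) (1 / 2)"
  have s0: "0 < s0" "s0 < 1" "f s0 < real p"
    using d(1) d(2)[of "min (d / 2) (1 / 2)"] f1 by (auto simp: s0_def)
  have lower: "f t \<ge> 1 / t powr a" if "t > 0" for t
  proof -
    have "(1::real) = (\<Sum>i<1. t ^ i)" by simp
    also have "\<dots> \<le> (\<Sum>i<p. t ^ i)"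
      using p that by (intro sum_mono2) auto
    finally show ?thesis using that by (simp add: f divide_right_mono)
  qed
  define b where "b = min s0 (real p powr (- 1 / a))"
  have b: "0 < b" "b \<le> s0" using p s0 by (auto simp: b_def)
  have small: "f t > f s0" if "0 < t" "t < b" for t
  proof -
    have "t powr a < (real p powr (- 1 / a)) powr a"
      using that a0 by (intro powr_less_mono2) (auto simp: b_def)
    also have "\<dots> = 1 / real p" using a0 p by (simp only: powr_powr) (simp add: powr_minus_divide)
    finally have "t powr a * real p < 1" using p by (simp add: field_simps)
    then have "1 / t powr a > real p" using that by (simp add: field_simps)
    then show ?thesis using lower[of t] that s0 by linarith
  qed
  have "continuous_on {b..1} f"
    using b by (intro continuous_at_imp_continuous_on ballI DERIV_isCont[OF deriv]) auto
  then obtain t where t: "t \<in> {b..1}" "\<And>s. s \<in> {b..1} \<Longrightarrow> f t \<le> f s"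
    using continuous_attains_inf[of "{b..1}" f] b s0 by force
  have tle: "f t \<le> f s0" using t(2)[of s0] b s0 by auto
  have "t \<noteq> 1" using tle s0 f1 by auto
  then have t01: "0 < t" "t < 1" using t(1) b by auto
  have tmin: "f t \<le> f s" if "0 < s" "s < 1" for s
    using small[of s] t(2)[of s] tle that by (cases "s < b") auto
  have "Gamma_min p k = f t"
    unfolding Gamma_min_def f_def[symmetric]
    using t01 tmin by (intro Least_equality) auto
  then show ?thesis using that[of t] t01 tmin by (auto simp: f_def)
qed

lemma Fp_space_comm_group:
  assumes "prime p"
  shows "comm_group (Fp_space p n)"
proof -
  interpret residues_prime p "residue_ring (int p)"
    using assms by unfold_locales
  show ?thesis
    unfolding Fp_space_def
    by (rule group.group_comm_groupI[OF product_group], rule a_group)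
       (auto simp: a_comm intro!: restrict_ext dest!: PiE_mem)
qed

end

theory Submission
  imports Defs
begin

text \<open>
  Pass greedily to a set of indices and a number \<open>m < k\<close> such that no zero sum has more than \<open>m\<close>
  distinct indices, while a constant proportion of the indices is covered by disjoint zero sums with
  exactly \<open>m\<close> distinct indices, all with the same pattern of coincidences. Reindexing by these
  disjoint zero sums, maximality of \<open>m\<close> forces every zero sum \<open>s\<close> to respect the pattern, so
  \<open>s j1 = s j2\<close> for some fixed \<open>j1 \<noteq> j2\<close>. If \<open>(a, b) = (s j1, s j)\<close> occurs in a zero sum with
  \<open>a \<noteq> b\<close>, then no other pair has the same sum \<open>x j1 a + x j b\<close>: exchanging the pairs would
  separate \<open>j1\<close> from \<open>j2\<close>. Hence there are at most \<open>k p\<^sup>n\<close> such pairs. An independent set of the graph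
  they form has size of order \<open>L\<^sup>2 / p\<^sup>n\<close> and carries only constant zero sums, so it is bounded by
  \<open>k \<Gamma>\<^sup>n\<close> by the multicolored sum-free theorem.

  For the latter, the indicator of zero sums is expanded modulo \<open>p\<close> into products of monomials, one
  factor of which always has low degree. Weights orthogonal to the low-degree monomials, whose
  product has a nonzero total, replace the slice rank argument.
\<close>

section \<open>The multicolored sum-free theorem\<close>

text \<open>Gaussian elimination modulo \<open>P\<close>, with \<open>S\<close> as the set of
  pivots. Each condition in \<open>B\<close> costs at most one index, and every remaining
  \<open>i\<close> keeps a weight that, within \<open>I\<close>, lives on \<open>S\<close> and
  \<open>i\<close> alone.\<close>

lemma separating_weights:
  fixes f :: "'b \<Rightarrow> 'a \<Rightarrow> int" and P :: int
  assumes P: "prime P" and I: "finite I" and B: "finite B"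
  shows "\<exists>S\<subseteq>I. card S \<le> card B \<and> (\<forall>i\<in>I - S. \<exists>w. (\<forall>b\<in>B. P dvd (\<Sum>h\<in>I. w h * f b h)) \<and>
    \<not> P dvd w i \<and> (\<forall>h\<in>I - S - {i}. w h = 0))"
  using B
proof (induction B)
  case empty
  have "\<not> P dvd 1" using P by auto
  then have "\<exists>w. \<not> P dvd w i \<and> (\<forall>h\<in>I - {} - {i}. w h = 0)" for i
    by (intro exI[of _ "\<lambda>h. if h = i then 1 else 0"]) auto
  then show ?case by (intro exI[of _ "{}"]) auto
next
  case (insert b B)
  then obtain S where S: "S \<subseteq> I" "card S \<le> card B" and
    ex: "\<forall>i\<in>I - S. \<exists>w. (\<forall>b\<in>B. P dvd (\<Sum>h\<in>I. w h * f b h)) \<and> \<not> P dvd w i \<and>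
      (\<forall>h\<in>I - S - {i}. w h = 0)" by auto
  from bchoice[OF ex] obtain w where
    w: "\<And>i b. i \<in> I - S \<Longrightarrow> b \<in> B \<Longrightarrow> P dvd (\<Sum>h\<in>I. w i h * f b h)"
      "\<And>i. i \<in> I - S \<Longrightarrow> \<not> P dvd w i i"
      "\<And>i h. i \<in> I - S \<Longrightarrow> h \<in> I - S - {i} \<Longrightarrow> w i h = 0" by metis
  have finS: "finite S" using S I finite_subset by auto
  define c where "c i = (\<Sum>h\<in>I. w i h * f b h)" for i
  show ?case
  proof (cases "\<forall>i\<in>I - S. P dvd c i")
    case True
    have "\<exists>v. (\<forall>b'\<in>insert b B. P dvd (\<Sum>h\<in>I. v h * f b' h)) \<and> \<not> P dvd v i \<and>
        (\<forall>h\<in>I - S - {i}. v h = 0)" if i: "i \<in> I - S" for i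
      using w(1,2,3)[OF i] True i by (intro exI[of _ "w i"]) (simp add: c_def)
    then show ?thesis using S insert.hyps by (intro exI[of _ S]) simp
  next
    case False
    then obtain i0 where i0: "i0 \<in> I - S" "\<not> P dvd c i0" by auto
    \<comment> \<open>Cross-multiplying with the weight of the new pivot \<open>i0\<close> cancels
      the new condition without division. At \<open>i\<close> the second term vanishes, so the value
      \<open>c i0 * w i i\<close> stays prime to \<open>P\<close>.\<close>
    have "\<exists>v. (\<forall>b'\<in>insert b B. P dvd (\<Sum>h\<in>I. v h * f b' h)) \<and> \<not> P dvd v i \<and>
        (\<forall>h\<in>I - insert i0 S - {i}. v h = 0)" if i: "i \<in> I - insert i0 S" for i
    proof (intro exI[of _ "\<lambda>h. c i0 * w i h - c i * w i0 h"] conjI ballI)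
      fix b' assume b': "b' \<in> insert b B"
      have eq: "(\<Sum>h\<in>I. (c i0 * w i h - c i * w i0 h) * f b' h) =
        c i0 * (\<Sum>h\<in>I. w i h * f b' h) - c i * (\<Sum>h\<in>I. w i0 h * f b' h)"
        by (simp add: sum_distrib_left sum_subtractf algebra_simps)
      show "P dvd (\<Sum>h\<in>I. (c i0 * w i h - c i * w i0 h) * f b' h)"
      proof (cases "b' = b")
        case True
        then show ?thesis unfolding eq by (simp add: c_def)
      next
        case False
        then show ?thesis unfolding eq using b' w(1) i i0 by simp
      qed
    next
      have "w i0 i = 0" using w(3) i i0 by auto
      then show "\<not> P dvd c i0 * w i i - c i * w i0 i"
        using P i0 w(2) i by (simp add: prime_dvd_mult_iff)
    qed (use w(3) i i0 in auto)
    then show ?thesis using S i0 finS insert.hyps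
      by (intro exI[of _ "insert i0 S"]) auto
  qed
qed

text \<open>A single index \<open>i\<close> is made to carry the whole sum modulo \<open>P\<close>.
  For \<open>j \<noteq> k1\<close> the weight lives on \<open>S j\<close> and \<open>i\<close>; the
  weight of \<open>k1\<close> is divisible by \<open>P\<close> on the union \<open>U\<close> of
  these sets, but not at \<open>i\<close>. The size hypothesis leaves room for the conditions from
  \<open>B\<close> together with those from \<open>U\<close>.\<close>

lemma weights_with_nonzero_product_sum:
  fixes f :: "'j \<Rightarrow> 'b \<Rightarrow> 'a \<Rightarrow> int" and P :: int
  assumes P: "prime P" and I: "finite I" and B: "finite B" and K: "finite K" "2 \<le> card K"
    and large: "card K * card B < card I"
  obtains w where "\<forall>j\<in>K. \<forall>b\<in>B. P dvd (\<Sum>h\<in>I. w j h * f j b h)"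
    "\<not> P dvd (\<Sum>h\<in>I. \<Prod>j\<in>K. w j h)"
proof -
  obtain k1 where k1: "k1 \<in> K" using K by fastforce
  have "card (K - {k1}) > 0" using K k1 by auto
  then obtain k2 where k2: "k2 \<in> K" "k2 \<noteq> k1" by (metis Diff_iff card_gt_0_iff ex_in_conv singletonI)
  define Q where "Q j S w \<longleftrightarrow> S \<subseteq> I \<and> card S \<le> card B \<and> (\<forall>i\<in>I - S.
    (\<forall>b\<in>B. P dvd (\<Sum>h\<in>I. w i h * f j b h)) \<and> \<not> P dvd w i i \<and> (\<forall>h\<in>I - S - {i}. w i h = 0))"
    for j S and w :: "'a \<Rightarrow> 'a \<Rightarrow> int"
  have "\<forall>j. \<exists>S. \<exists>w. Q j S w"
  proof
    fix j
    obtain S where S: "S \<subseteq> I" "card S \<le> card B" and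
    ex: "\<forall>i\<in>I - S. \<exists>w. (\<forall>b\<in>B. P dvd (\<Sum>h\<in>I. w h * f j b h)) \<and> \<not> P dvd w i \<and>
      (\<forall>h\<in>I - S - {i}. w h = 0)"
      using separating_weights[OF P I B, of "f j"] by auto
    from bchoice[OF ex] show "\<exists>S. \<exists>w. Q j S w" using S unfolding Q_def by blast
  qed
  then obtain S w where Q: "\<And>j. Q j (S j) (w j)" by metis
  have Sj: "S j \<subseteq> I" "card (S j) \<le> card B" "finite (S j)" for j
    using Q[of j] I finite_subset by (auto simp: Q_def)
  define U where "U = (\<Union>j\<in>K - {k1}. S j)"
  have U: "finite U" "U \<subseteq> I" using Sj K by (auto simp: U_def)
  have "card U \<le> (\<Sum>j\<in>K - {k1}. card (S j))"
    unfolding U_def using K by (intro card_UN_le) auto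
  also have "\<dots> \<le> card (K - {k1}) * card B"
    using sum_bounded_above[of "K - {k1}" "\<lambda>j. card (S j)" "card B"] Sj by auto
  finally have "card U + card B \<le> Suc (card (K - {k1})) * card B" by simp
  also have "Suc (card (K - {k1})) = card K" using K k1 by (simp add: card_Suc_Diff1)
  finally have cU: "card U + card B < card I" using large by simp
  \<comment> \<open>For \<open>k1\<close>, additionally demand that the weight vanish on \<open>U\<close>.\<close>
  define g where "g = case_sum (f k1) (\<lambda>u h. if h = u then 1 else 0 :: int)"
  obtain S' where S': "S' \<subseteq> I" "card S' \<le> card (B <+> U)" and
    ex': "\<forall>i\<in>I - S'. \<exists>w. (\<forall>b\<in>B <+> U. P dvd (\<Sum>h\<in>I. w h * g b h)) \<and> \<not> P dvd w i \<and>
      (\<forall>h\<in>I - S' - {i}. w h = 0)"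
    using separating_weights[OF P I, of "B <+> U" g] B U by auto
  have "card S' < card I" using S'(2) cU B U by (simp add: card_Plus)
  then obtain i where i: "i \<in> I" "i \<notin> S'"
    by (meson S'(1) less_le_not_le subset_antisym card_mono finite_subset I subset_iff)
  then obtain v where v: "\<forall>b\<in>B <+> U. P dvd (\<Sum>h\<in>I. v h * g b h)" "\<not> P dvd v i"
    using ex' by blast
  have vU: "P dvd v u" if "u \<in> U" for u
  proof -
    have "P dvd (\<Sum>h\<in>I. v h * g (Inr u) h)" using v(1) that by blast
    also have "(\<Sum>h\<in>I. v h * g (Inr u) h) = (\<Sum>h\<in>I. if h = u then v h else 0)"
      by (intro sum.cong) (auto simp: g_def)
    also have "\<dots> = v u" using that U I by (auto simp: sum.delta)
    finally show ?thesis .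
  qed
  have iS: "i \<notin> S j" if "j \<in> K - {k1}" for j using v(2) vU that by (auto simp: U_def)
  define W where "W j = (if j = k1 then v else w j i)" for j
  show thesis
  proof (rule that[of W], intro ballI)
    fix j b assume jb: "j \<in> K" "b \<in> B"
    show "P dvd (\<Sum>h\<in>I. W j h * f j b h)"
    proof (cases "j = k1")
      case True
      then show ?thesis using bspec[OF v(1) InlI[OF jb(2)]] by (simp add: W_def g_def)
    next
      case False
      then show ?thesis using Q[of j] iS[of j] i jb by (simp add: W_def Q_def)
    qed
  next
    \<comment> \<open>Away from \<open>i\<close>, one further colour \<open>k2\<close> suffices: on
      \<open>S k2\<close> the weight of \<open>k1\<close> is divisible by \<open>P\<close>, and
      elsewhere that of \<open>k2\<close> is zero.\<close>
    have dv: "P dvd (\<Prod>j\<in>K. W j h)" if h: "h \<in> I - {i}" for h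
    proof (cases "h \<in> S k2")
      case True
      then have "P dvd W k1 h" using vU k2 by (auto simp: W_def U_def)
      then show ?thesis using k1 K by (meson dvd_prodI dvd_trans)
    next
      case False
      then have "W k2 h = 0" using Q[of k2] iS[of k2] k2 i h by (auto simp: W_def Q_def)
      then have "(\<Prod>j\<in>K. W j h) = 0" using k2 K by (intro prod_zero) auto
      then show ?thesis by simp
    qed
    have "\<not> P dvd (\<Prod>j\<in>K. W j i)"
      using P K(1) Q iS i v(2) by (auto simp: prime_dvd_prod_iff W_def Q_def)
    moreover have "(\<Sum>h\<in>I. \<Prod>j\<in>K. W j h) = (\<Prod>j\<in>K. W j i) + (\<Sum>h\<in>I - {i}. \<Prod>j\<in>K. W j h)"
      using I i by (simp add: sum.remove)
    ultimately show "\<not> P dvd (\<Sum>h\<in>I. \<Prod>j\<in>K. W j h)"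
      using dvd_sum[of "I - {i}" P, OF dv] by (simp add: dvd_add_left_iff)
  qed
qed

section \<open>Expanding the indicator of zero sums into monomials\<close>

text \<open>\<open>None\<close> stands for the constant term 1 and \<open>Some \<phi>\<close> for
  one word of length \<open>q\<close> in the expanded power, with \<open>e\<close> counting each
  letter. Words are not merged, so no multinomial coefficients appear.\<close>

lemma one_minus_power_expansion:
  fixes K :: "'j set"
  assumes K: "finite K"
  obtains \<Phi> :: "(nat \<Rightarrow> 'j) option set" and c :: "(nat \<Rightarrow> 'j) option \<Rightarrow> int"
    and e :: "(nat \<Rightarrow> 'j) option \<Rightarrow> 'j \<Rightarrow> nat"
  where "finite \<Phi>" "\<forall>\<psi>\<in>\<Phi>. (\<Sum>j\<in>K. e \<psi> j) \<le> q"
    "\<forall>a. 1 - (\<Sum>j\<in>K. a j) ^ q = (\<Sum>\<psi>\<in>\<Phi>. c \<psi> * (\<Prod>j\<in>K. a j ^ e \<psi> j))"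
proof -
  define F where "F = ({..<q} \<rightarrow>\<^sub>E K)"
  have F: "finite F" using K by (auto simp: F_def intro!: finite_PiE)
  define c :: "(nat \<Rightarrow> 'j) option \<Rightarrow> int" where "c = case_option 1 (\<lambda>_. - 1)"
  define e :: "(nat \<Rightarrow> 'j) option \<Rightarrow> 'j \<Rightarrow> nat"
    where "e = case_option (\<lambda>_. 0) (\<lambda>\<phi> j. card {r\<in>{..<q}. \<phi> r = j})"
  show thesis
  proof (rule that[of "insert None (Some ` F)" e c], goal_cases)
    case 2
    show ?case
    proof
      fix \<psi> assume \<psi>: "\<psi> \<in> insert None (Some ` F)"
      have "(\<Sum>j\<in>K. card {r\<in>{..<q}. \<phi> r = j}) = q" if "\<phi> \<in> F" for \<phi>
        using sum.group[of "{..<q}" K \<phi> "\<lambda>_. 1::nat"] that K by (force simp: F_def)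
      then show "(\<Sum>j\<in>K. e \<psi> j) \<le> q" using \<psi> by (auto simp: e_def)
    qed
  next
    case 3
    show ?case
    proof
      fix a :: "'j \<Rightarrow> int"
      have "(\<Sum>j\<in>K. a j) ^ q = (\<Prod>r<q. \<Sum>j\<in>K. a j)" by simp
      also have "\<dots> = (\<Sum>\<phi>\<in>F. \<Prod>r<q. a (\<phi> r))"
        unfolding F_def using K by (intro prod_sum_PiE) auto
      also have "\<dots> = (\<Sum>\<phi>\<in>F. \<Prod>j\<in>K. a j ^ e (Some \<phi>) j)"
      proof (intro sum.cong refl)
        fix \<phi> assume "\<phi> \<in> F"
        then have "(\<Prod>r<q. a (\<phi> r)) = (\<Prod>j\<in>K. \<Prod>r\<in>{r\<in>{..<q}. \<phi> r = j}. a (\<phi> r))"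
          using K by (intro prod.group[symmetric]) (auto simp: F_def)
        then show "(\<Prod>r<q. a (\<phi> r)) = (\<Prod>j\<in>K. a j ^ e (Some \<phi>) j)"
          by (simp add: e_def)
      qed
      finally show "1 - (\<Sum>j\<in>K. a j) ^ q =
          (\<Sum>\<psi>\<in>insert None (Some ` F). c \<psi> * (\<Prod>j\<in>K. a j ^ e \<psi> j))"
        using F by (simp add: sum.reindex c_def e_def sum_negf)
    qed
  qed (use F in auto)
qed

text \<open>Exponent vectors of monomials of degree at most \<open>n * (p - 1) / k\<close>,
  multiplied out to avoid division. The threshold is an average: if \<open>k\<close> degrees add up
  to at most \<open>n * (p - 1)\<close>, one of them meets it.\<close>

definition low_degree :: "nat \<Rightarrow> nat \<Rightarrow> nat \<Rightarrow> (nat \<Rightarrow> nat) set" where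
  "low_degree p n k = {\<alpha> \<in> {..<n} \<rightarrow>\<^sub>E {..<p}. k * (\<Sum>l<n. \<alpha> l) \<le> n * (p - 1)}"

lemma finite_low_degree: "finite (low_degree p n k)"
  unfolding low_degree_def by (rule finite_subset[of _ "{..<n} \<rightarrow>\<^sub>E {..<p}"]) (auto intro: finite_PiE)

text \<open>After expansion, each term is a product of one monomial per colour, and its sum over
  \<open>s\<close> factors into one weighted sum per colour. The total degree is at most
  \<open>n * (p - 1)\<close>, so some colour has a low-degree monomial, to which its weight is
  orthogonal.\<close>

lemma dvd_weighted_indicator_sum:
  fixes x :: "'j \<Rightarrow> 'a \<Rightarrow> nat \<Rightarrow> int"
  assumes K: "finite K" "K \<noteq> {}" and I: "finite I" and p: "p \<ge> 1"
    and w: "\<And>j \<alpha>. j \<in> K \<Longrightarrow> \<alpha> \<in> low_degree p n (card K) \<Longrightarrow>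
      P dvd (\<Sum>i\<in>I. w j i * (\<Prod>l<n. x j i l ^ \<alpha> l))"
  shows "P dvd (\<Sum>s\<in>K \<rightarrow>\<^sub>E I. (\<Prod>j\<in>K. w j (s j)) * (\<Prod>l<n. 1 - (\<Sum>j\<in>K. x j (s j) l) ^ (p - 1)))"
proof -
  obtain \<Phi> :: "(nat \<Rightarrow> 'j) option set" and c :: "_ \<Rightarrow> int" and e where
    \<Phi>: "finite \<Phi>" and e: "\<forall>\<psi>\<in>\<Phi>. (\<Sum>j\<in>K. e \<psi> j) \<le> p - 1" and
    expand: "\<forall>a. 1 - (\<Sum>j\<in>K. a j) ^ (p - 1) = (\<Sum>\<psi>\<in>\<Phi>. c \<psi> * (\<Prod>j\<in>K. a j ^ e \<psi> j))"
    by (rule one_minus_power_expansion[OF K(1), where q = "p - 1"]) (rule that)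
  note expand = spec[OF expand]
  define C where "C \<Psi> = (\<Prod>l<n. c (\<Psi> l))" for \<Psi> :: "nat \<Rightarrow> (nat \<Rightarrow> 'j) option"
  define m where "m \<Psi> j i = (\<Prod>l<n. x j i l ^ e (\<Psi> l) j)" for \<Psi> j i
  have prod: "(\<Prod>l<n. 1 - (\<Sum>j\<in>K. x j (s j) l) ^ (p - 1)) =
      (\<Sum>\<Psi>\<in>{..<n} \<rightarrow>\<^sub>E \<Phi>. C \<Psi> * (\<Prod>j\<in>K. m \<Psi> j (s j)))" for s
  proof -
    have "(\<Prod>l<n. 1 - (\<Sum>j\<in>K. x j (s j) l) ^ (p - 1)) =
        (\<Sum>\<Psi>\<in>{..<n} \<rightarrow>\<^sub>E \<Phi>. \<Prod>l<n. c (\<Psi> l) * (\<Prod>j\<in>K. x j (s j) l ^ e (\<Psi> l) j))"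
      unfolding expand using \<Phi> by (intro prod_sum_PiE) auto
    also have "\<dots> = (\<Sum>\<Psi>\<in>{..<n} \<rightarrow>\<^sub>E \<Phi>. C \<Psi> * (\<Prod>j\<in>K. m \<Psi> j (s j)))"
      unfolding C_def m_def prod.distrib by (subst prod.swap) simp
    finally show ?thesis .
  qed
  have "(\<Sum>s\<in>K \<rightarrow>\<^sub>E I. (\<Prod>j\<in>K. w j (s j)) * (\<Prod>l<n. 1 - (\<Sum>j\<in>K. x j (s j) l) ^ (p - 1))) =
      (\<Sum>s\<in>K \<rightarrow>\<^sub>E I. \<Sum>\<Psi>\<in>{..<n} \<rightarrow>\<^sub>E \<Phi>. C \<Psi> * (\<Prod>j\<in>K. w j (s j) * m \<Psi> j (s j)))"
    unfolding prod by (simp add: sum_distrib_left prod.distrib mult_ac)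
  also have "\<dots> = (\<Sum>\<Psi>\<in>{..<n} \<rightarrow>\<^sub>E \<Phi>. C \<Psi> * (\<Sum>s\<in>K \<rightarrow>\<^sub>E I. \<Prod>j\<in>K. w j (s j) * m \<Psi> j (s j)))"
    by (subst sum.swap) (simp add: sum_distrib_left)
  also have "\<dots> = (\<Sum>\<Psi>\<in>{..<n} \<rightarrow>\<^sub>E \<Phi>. C \<Psi> * (\<Prod>j\<in>K. \<Sum>i\<in>I. w j i * m \<Psi> j i))"
    using K I by (subst prod_sum_PiE) auto
  also have "P dvd \<dots>"
  proof (intro dvd_sum dvd_mult)
    fix \<Psi> assume \<Psi>: "\<Psi> \<in> {..<n} \<rightarrow>\<^sub>E \<Phi>"
    have "(\<Sum>j\<in>K. \<Sum>l<n. e (\<Psi> l) j) = (\<Sum>l<n. \<Sum>j\<in>K. e (\<Psi> l) j)" by (rule sum.swap)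
    also have "\<dots> \<le> (\<Sum>l<n. p - 1)" using e \<Psi> by (intro sum_mono) (auto simp: PiE_iff)
    finally have tot: "(\<Sum>j\<in>K. \<Sum>l<n. e (\<Psi> l) j) \<le> n * (p - 1)" by simp
    obtain j where j: "j \<in> K" "card K * (\<Sum>l<n. e (\<Psi> l) j) \<le> n * (p - 1)"
    proof (rule ccontr)
      assume "\<not> thesis"
      then have "\<forall>j\<in>K. n * (p - 1) < card K * (\<Sum>l<n. e (\<Psi> l) j)" using that by force
      then have "(\<Sum>j\<in>K. n * (p - 1)) < (\<Sum>j\<in>K. card K * (\<Sum>l<n. e (\<Psi> l) j))"
        using K by (intro sum_strict_mono) auto
      then have "card K * (n * (p - 1)) < card K * (\<Sum>j\<in>K. \<Sum>l<n. e (\<Psi> l) j)"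
        by (simp add: sum_distrib_left)
      then show False using tot by simp
    qed
    define \<alpha> where "\<alpha> = (\<lambda>l\<in>{..<n}. e (\<Psi> l) j)"
    \<comment> \<open>The degree bound in each single coordinate keeps every exponent below
      \<open>p\<close>, as \<open>low_degree\<close> demands.\<close>
    have "e (\<Psi> l) j < p" if "l < n" for l
      using member_le_sum[of j K "e (\<Psi> l)"] bspec[OF e, of "\<Psi> l"] \<Psi> that j K p by (auto simp: PiE_iff)
    then have "\<alpha> \<in> low_degree p n (card K)" using j by (auto simp: \<alpha>_def low_degree_def)
    from w[OF j(1) this] have "P dvd (\<Sum>i\<in>I. w j i * m \<Psi> j i)"
      by (simp add: m_def \<alpha>_def)
    then show "P dvd (\<Prod>j\<in>K. \<Sum>i\<in>I. w j i * m \<Psi> j i)"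
      using j K by (meson dvd_prodI dvd_trans)
  qed
  finally show ?thesis .
qed

text \<open>The index type is arbitrary, so that whole zero sums can later serve as indices
  themselves.\<close>

definition zero_sum :: "nat \<Rightarrow> nat \<Rightarrow> 'j set \<Rightarrow> ('j \<Rightarrow> 'a \<Rightarrow> nat \<Rightarrow> int) \<Rightarrow> ('j \<Rightarrow> 'a) \<Rightarrow> bool" where
  "zero_sum p n K x s \<longleftrightarrow> (\<forall>l<n. int p dvd (\<Sum>j\<in>K. x j (s j) l))"

lemma int_fermat:
  fixes a :: int
  assumes "prime p" "\<not> int p dvd a"
  shows "[a ^ (p - 1) = 1] (mod int p)"
proof -
  define b where "b = nat (a mod int p)"
  have p: "p > 0" using assms prime_gt_0_nat by simp
  have b: "int b = a mod int p" using p by (simp add: b_def)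
  have "\<not> p dvd b"
    using assms(2) b by (metis int_dvd_int_iff dvd_mod_iff dvd_refl)
  from fermat_theorem[OF assms(1) this] have "[int b ^ (p - 1) = 1] (mod int p)"
    by (metis cong_int_iff of_nat_1 of_nat_power)
  moreover have "[int b ^ (p - 1) = a ^ (p - 1)] (mod int p)"
    unfolding b by (intro cong_pow) (simp add: cong_def)
  ultimately show ?thesis using cong_trans cong_sym by blast
qed

text \<open>By Fermat, \<open>1 - a ^ (p - 1)\<close> is 1 modulo \<open>p\<close> if
  \<open>p\<close> divides \<open>a\<close>, and 0 otherwise.\<close>

lemma zero_sum_indicator:
  assumes "prime p"
  shows "[(\<Prod>l<n. 1 - (\<Sum>j\<in>K. x j (s j) l) ^ (p - 1)) = (if zero_sum p n K x s then 1 else 0)] (mod int p)"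
proof (cases "zero_sum p n K x s")
  case True
  have p: "p - 1 > 0" using prime_gt_1_nat[OF assms] by simp
  have "[(\<Prod>l<n. 1 - (\<Sum>j\<in>K. x j (s j) l) ^ (p - 1)) = (\<Prod>l<n. 1)] (mod int p)"
    using True p by (intro cong_prod) (auto simp: zero_sum_def cong_iff_dvd_diff dvd_power_iff intro: dvd_trans dvd_power)
  then show ?thesis using True by simp
next
  case False
  then obtain l where l: "l < n" "\<not> int p dvd (\<Sum>j\<in>K. x j (s j) l)" by (auto simp: zero_sum_def)
  have "int p dvd 1 - (\<Sum>j\<in>K. x j (s j) l) ^ (p - 1)"
    using int_fermat[OF assms l(2)] by (simp add: cong_iff_dvd_diff dvd_diff_commute)
  then have "int p dvd (\<Prod>l<n. 1 - (\<Sum>j\<in>K. x j (s j) l) ^ (p - 1))"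
    using l by (meson dvd_prodI dvd_trans finite_lessThan lessThan_iff)
  then show ?thesis using False by (simp add: cong_iff_dvd_diff)
qed

text \<open>If \<open>I\<close> were larger, some weights orthogonal to all low-degree monomials
  would have a total of products that is nonzero modulo \<open>p\<close>. The weighted sum of the
  indicator over all choices equals this total, as only constant choices are zero sums, yet it is 0
  by orthogonality.\<close>

lemma multicolored_sum_free_card:
  fixes x :: "'j \<Rightarrow> 'a \<Rightarrow> nat \<Rightarrow> int"
  assumes p: "prime p" and K: "finite K" "2 \<le> card K" and I: "finite I"
    and diag: "\<And>i. i \<in> I \<Longrightarrow> zero_sum p n K x (\<lambda>_\<in>K. i)"
    and free: "\<And>s j j'. s \<in> K \<rightarrow>\<^sub>E I \<Longrightarrow> zero_sum p n K x s \<Longrightarrow> j \<in> K \<Longrightarrow> j' \<in> K \<Longrightarrow> s j = s j'"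
  shows "card I \<le> card K * card (low_degree p n (card K))"
proof (rule ccontr)
  assume "\<not> ?thesis"
  then have large: "card K * card (low_degree p n (card K)) < card I" by simp
  have P: "prime (int p)" using p by simp
  obtain w where w: "\<forall>j\<in>K. \<forall>\<alpha>\<in>low_degree p n (card K).
      int p dvd (\<Sum>i\<in>I. w j i * (\<Prod>l<n. x j i l ^ \<alpha> l))"
    and nz: "\<not> int p dvd (\<Sum>i\<in>I. \<Prod>j\<in>K. w j i)"
    by (rule weights_with_nonzero_product_sum[OF P I finite_low_degree K large,
        of "\<lambda>j \<alpha> i. \<Prod>l<n. x j i l ^ \<alpha> l"]) (rule that)
  have K0: "K \<noteq> {}" using K by auto
  then obtain j0 where j0: "j0 \<in> K" by auto
  define D where "D = (\<lambda>i. \<lambda>_\<in>K. i) ` I"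
  have fin: "finite (K \<rightarrow>\<^sub>E I)" using K I by (auto intro: finite_PiE)
  have D: "{s \<in> K \<rightarrow>\<^sub>E I. zero_sum p n K x s} = D"
  proof (intro equalityI subsetI)
    fix s assume s: "s \<in> {s \<in> K \<rightarrow>\<^sub>E I. zero_sum p n K x s}"
    have "s = (\<lambda>_\<in>K. s j0)"
    proof
      fix j
      show "s j = (\<lambda>_\<in>K. s j0) j"
        using s free[of s j j0] j0 by (cases "j \<in> K") auto
    qed
    moreover have "s j0 \<in> I" using s j0 by auto
    ultimately show "s \<in> D" unfolding D_def by (rule image_eqI)
  next
    fix s assume "s \<in> D"
    then obtain i where "i \<in> I" "s = (\<lambda>_\<in>K. i)" by (auto simp: D_def)
    then show "s \<in> {s \<in> K \<rightarrow>\<^sub>E I. zero_sum p n K x s}" using diag[of i] by auto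
  qed
  have inj: "inj_on (\<lambda>i. \<lambda>_\<in>K. i) I" using j0 by (auto simp: inj_on_def fun_eq_iff)
  have "[(\<Sum>s\<in>K \<rightarrow>\<^sub>E I. (\<Prod>j\<in>K. w j (s j)) * (\<Prod>l<n. 1 - (\<Sum>j\<in>K. x j (s j) l) ^ (p - 1))) =
     (\<Sum>s\<in>K \<rightarrow>\<^sub>E I. (\<Prod>j\<in>K. w j (s j)) * (if zero_sum p n K x s then 1 else 0))] (mod int p)"
    by (intro cong_sum cong_mult cong_refl zero_sum_indicator p)
  also have "(\<Sum>s\<in>K \<rightarrow>\<^sub>E I. (\<Prod>j\<in>K. w j (s j)) * (if zero_sum p n K x s then 1 else 0)) =
     (\<Sum>s | s \<in> K \<rightarrow>\<^sub>E I \<and> zero_sum p n K x s. \<Prod>j\<in>K. w j (s j))"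
    using fin by (auto simp: sum.inter_filter intro!: sum.cong)
  also have "\<dots> = (\<Sum>i\<in>I. \<Prod>j\<in>K. w j i)"
    using D inj by (simp add: D_def sum.reindex)
  finally have cong: "[(\<Sum>s\<in>K \<rightarrow>\<^sub>E I. (\<Prod>j\<in>K. w j (s j)) * (\<Prod>l<n. 1 - (\<Sum>j\<in>K. x j (s j) l) ^ (p - 1))) =
      (\<Sum>i\<in>I. \<Prod>j\<in>K. w j i)] (mod int p)" .
  have "int p dvd (\<Sum>s\<in>K \<rightarrow>\<^sub>E I. (\<Prod>j\<in>K. w j (s j)) * (\<Prod>l<n. 1 - (\<Sum>j\<in>K. x j (s j) l) ^ (p - 1)))"
    using w prime_ge_1_nat[OF p] by (intro dvd_weighted_indicator_sum K(1) K0 I) auto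
  then show False using nz cong_dvd_iff[OF cong] by simp
qed

section \<open>Counting low-degree monomials\<close>

text \<open>An exponential moment bound: give a vector of degree \<open>d\<close> the weight
  \<open>t ^ d\<close>. As \<open>t < 1\<close>, each counted vector weighs at least
  \<open>t powr (n * (p - 1) / k)\<close>, while all vectors in the box together weigh
  \<open>(\<Sum>i<p. t ^ i) ^ n\<close>.\<close>

lemma card_low_degree_le:
  assumes t: "0 < t" "t < 1" and k: "k \<ge> 1" and p: "p \<ge> 1"
  shows "real (card (low_degree p n k)) \<le> Gamma_fun p k t ^ n"
proof -
  let ?a = "(real p - 1) / real k"
  have "real (card (low_degree p n k)) * (t powr ?a) ^ n =
      (\<Sum>\<alpha>\<in>low_degree p n k. t powr (real n * ?a))"
    using t by (simp add: powr_power mult_ac)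
  also have "\<dots> \<le> (\<Sum>\<alpha>\<in>low_degree p n k. \<Prod>l<n. t ^ \<alpha> l)"
  proof (intro sum_mono)
    fix \<alpha> assume "\<alpha> \<in> low_degree p n k"
    then have "real (k * (\<Sum>l<n. \<alpha> l)) \<le> real (n * (p - 1))"
      unfolding low_degree_def by (simp only: of_nat_le_iff mem_Collect_eq)
    then have "real (\<Sum>l<n. \<alpha> l) \<le> real n * ?a" using k p by (simp add: field_simps of_nat_diff)
    then have "t powr (real n * ?a) \<le> t powr (real (\<Sum>l<n. \<alpha> l))"
      using t by (intro powr_mono') auto
    also have "\<dots> = (\<Prod>l<n. t ^ \<alpha> l)" using t by (simp only: powr_realpow power_sum)
    finally show "t powr (real n * ?a) \<le> (\<Prod>l<n. t ^ \<alpha> l)" .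
  qed
  also have "\<dots> \<le> (\<Sum>\<alpha>\<in>{..<n} \<rightarrow>\<^sub>E {..<p}. \<Prod>l<n. t ^ \<alpha> l)"
  proof (intro sum_mono2)
    show "finite ({..<n} \<rightarrow>\<^sub>E {..<p})" by (rule finite_PiE) auto
    show "low_degree p n k \<subseteq> {..<n} \<rightarrow>\<^sub>E {..<p}" by (auto simp: low_degree_def)
  qed (use t in \<open>simp add: prod_nonneg\<close>)
  also have "\<dots> = (\<Sum>i<p. t ^ i) ^ n"
    by (subst prod_sum_PiE[symmetric]) auto
  finally show ?thesis using t by (simp add: Gamma_fun_def power_divide field_simps)
qed

section \<open>Zero sums without distinct indices\<close>

text \<open>A Turan-type bound. At least half of the vertices have low degree, and a maximal
  independent set among them covers them all by its closed neighbourhoods. Edges count in both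
  directions, and loops are harmless.\<close>

lemma independent_subset_exists:
  assumes V: "finite V" and E: "E \<subseteq> V \<times> V"
  obtains I where "I \<subseteq> V" "\<forall>a\<in>I. \<forall>b\<in>I. (a, b) \<in> E \<longrightarrow> a = b"
    "(card V)\<^sup>2 \<le> 2 * card I * (card V + 4 * card E)"
proof -
  let ?N = "card V" and ?e = "card E"
  have finE: "finite E" using E V by (meson finite_SigmaI finite_subset)
  define nb where "nb a = {b\<in>V. (a, b) \<in> E \<or> (b, a) \<in> E}" for a
  have fnb: "finite (nb a)" for a using V by (simp add: nb_def)
  define deg where "deg a = card (nb a)" for a
  have degsum: "(\<Sum>a\<in>V. deg a) \<le> 2 * ?e"
  proof -
    have "deg a \<le> card {b\<in>V. (a, b) \<in> E} + card {b\<in>V. (b, a) \<in> E}" for a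
    proof -
      have "nb a = {b\<in>V. (a, b) \<in> E} \<union> {b\<in>V. (b, a) \<in> E}" by (auto simp: nb_def)
      then show ?thesis unfolding deg_def by (metis card_Un_le)
    qed
    then have "(\<Sum>a\<in>V. deg a) \<le> (\<Sum>a\<in>V. card {b\<in>V. (a, b) \<in> E} + card {b\<in>V. (b, a) \<in> E})"
      by (rule sum_mono)
    also have "\<dots> = card (SIGMA a:V. {b\<in>V. (a, b) \<in> E}) + card (SIGMA a:V. {b\<in>V. (b, a) \<in> E})"
      using V by (simp add: sum.distrib)
    also have "(SIGMA a:V. {b\<in>V. (a, b) \<in> E}) = E" using E by auto
    also have "(SIGMA a:V. {b\<in>V. (b, a) \<in> E}) = E\<inverse>" using E by auto
    finally show ?thesis by simp
  qed
  \<comment> \<open>The threshold is twice the bound \<open>2 * card E / card V\<close> on the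
    average degree, so by Markov's inequality at most half of the vertices exceed it.\<close>
  define H where "H = {a\<in>V. deg a * ?N \<le> 4 * ?e}"
  have H: "finite H" "H \<subseteq> V" using V by (auto simp: H_def)
  have half: "?N \<le> 2 * card H"
  proof -
    have "(4 * ?e + 1) * card (V - H) = (\<Sum>a\<in>V - H. 4 * ?e + 1)" by simp
    also have "\<dots> \<le> (\<Sum>a\<in>V - H. deg a * ?N)" by (intro sum_mono) (auto simp: H_def)
    also have "\<dots> \<le> (\<Sum>a\<in>V. deg a * ?N)" using V by (intro sum_mono2) auto
    also have "\<dots> \<le> 2 * ?e * ?N" using degsum by (simp flip: sum_distrib_right)
    finally have le: "(4 * ?e + 1) * card (V - H) \<le> 2 * ?e * ?N" .
    have "2 * card (V - H) \<le> ?N"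
    proof (cases "?e = 0")
      case False
      have "(2 * ?e) * (2 * card (V - H)) \<le> (4 * ?e + 1) * card (V - H)" by (simp add: algebra_simps)
      then have "(2 * ?e) * (2 * card (V - H)) \<le> (2 * ?e) * ?N" using le by (rule order.trans)
      then show ?thesis using False by simp
    qed (use le in simp)
    moreover have "card (V - H) = ?N - card H" using H by (simp add: card_Diff_subset)
    moreover have "card H \<le> ?N" using H V by (simp add: card_mono)
    ultimately show ?thesis by simp
  qed
  define \<I> where "\<I> = {I. I \<subseteq> H \<and> (\<forall>a\<in>I. \<forall>b\<in>I. (a, b) \<in> E \<longrightarrow> a = b)}"
  have "finite \<I>" using H by (intro finite_subset[of \<I> "Pow H"]) (auto simp: \<I>_def)
  moreover have "{} \<in> \<I>" by (simp add: \<I>_def)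
  ultimately obtain I where I: "I \<in> \<I>" and max: "\<And>J. J \<in> \<I> \<Longrightarrow> I \<subseteq> J \<Longrightarrow> I = J"
    using finite_has_maximal[of \<I>] by auto
  have IH: "I \<subseteq> H" "finite I" using I H finite_subset by (auto simp: \<I>_def)
  have "H \<subseteq> (\<Union>a\<in>I. insert a (nb a))"
  proof
    fix b assume b: "b \<in> H"
    show "b \<in> (\<Union>a\<in>I. insert a (nb a))"
    proof (rule ccontr)
      assume n: "b \<notin> (\<Union>a\<in>I. insert a (nb a))"
      have "insert b I \<in> \<I>" using I b n H by (auto simp: \<I>_def nb_def)
      then show False using max n by blast
    qed
  qed
  then have "card H \<le> card (\<Union>a\<in>I. insert a (nb a))" using IH fnb by (intro card_mono) auto
  also have "\<dots> \<le> (\<Sum>a\<in>I. card (insert a (nb a)))" using IH by (intro card_UN_le)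
  also have "\<dots> \<le> (\<Sum>a\<in>I. 1 + deg a)" using fnb by (intro sum_mono) (auto simp: deg_def card_insert_if)
  finally have "card H * ?N \<le> (\<Sum>a\<in>I. 1 + deg a) * ?N" by (rule mult_right_mono) simp
  also have "\<dots> = (\<Sum>a\<in>I. ?N + deg a * ?N)" by (simp add: sum_distrib_right)
  also have "\<dots> \<le> (\<Sum>a\<in>I. ?N + 4 * ?e)" using IH by (intro sum_mono) (auto simp: H_def)
  finally have "card H * ?N \<le> card I * (?N + 4 * ?e)" by simp
  moreover have "?N * ?N \<le> 2 * card H * ?N" using half by (rule mult_right_mono) simp
  ultimately have "?N\<^sup>2 \<le> 2 * card I * (?N + 4 * ?e)" unfolding power2_eq_square by linarith
  then show thesis using that[of I] I H by (auto simp: \<I>_def)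
qed

text \<open>The exchange that will separate two positions assumed to agree in every zero
  sum.\<close>

lemma zero_sum_replace:
  assumes K: "finite K" "i \<in> K" "j \<in> K" "i \<noteq> j" and s: "zero_sum p n K x s"
    and eq: "\<And>l. l < n \<Longrightarrow> [x i a l + x j b l = x i (s i) l + x j (s j) l] (mod int p)"
  shows "zero_sum p n K x (s(i := a, j := b))"
  unfolding zero_sum_def
proof (intro allI impI)
  fix l assume l: "l < n"
  have split: "(\<Sum>h\<in>K. g h) = g i + g j + (\<Sum>h\<in>K - {i} - {j}. g h)" for g :: "_ \<Rightarrow> int"
    using K by (simp add: sum.remove)
  have "(\<Sum>h\<in>K. x h ((s(i := a, j := b)) h) l) =
      x i a l + x j b l + (\<Sum>h\<in>K - {i} - {j}. x h (s h) l)"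
    unfolding split using K by (auto intro!: sum.cong)
  also have "[\<dots> = x i (s i) l + x j (s j) l + (\<Sum>h\<in>K - {i} - {j}. x h (s h) l)] (mod int p)"
    by (intro cong_add eq l cong_refl)
  also have "x i (s i) l + x j (s j) l + (\<Sum>h\<in>K - {i} - {j}. x h (s h) l) = (\<Sum>h\<in>K. x h (s h) l)"
    unfolding split by simp
  finally show "int p dvd (\<Sum>h\<in>K. x h ((s(i := a, j := b)) h) l)"
    using s l unfolding zero_sum_def by (simp only: cong_dvd_iff)
qed

lemma card_box: "card ({..<n} \<rightarrow>\<^sub>E {0..<int p}) = p ^ n"
  by (simp add: card_PiE)

text \<open>For \<open>j \<noteq> j1\<close>, an exchange shows that a pair in \<open>E j\<close> is
  determined by its sum, so there are at most \<open>p ^ n\<close> of them. A set independent of all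
  these pairs admits only constant zero sums. The sum-free bound limits its size from above, and the
  edge count from below.\<close>

lemma card_square_le_of_coincidence:
  fixes x :: "'j \<Rightarrow> 'a \<Rightarrow> nat \<Rightarrow> int"
  assumes p: "prime p" and K: "finite K" "j1 \<in> K" "j2 \<in> K" "j1 \<noteq> j2" and T: "finite T"
    and box: "\<And>j i. j \<in> K \<Longrightarrow> i \<in> T \<Longrightarrow> x j i \<in> {..<n} \<rightarrow>\<^sub>E {0..<int p}"
    and inj: "\<And>j. j \<in> K \<Longrightarrow> inj_on (x j) T"
    and diag: "\<And>i. i \<in> T \<Longrightarrow> zero_sum p n K x (\<lambda>_\<in>K. i)"
    and coinc: "\<And>s. s \<in> K \<rightarrow>\<^sub>E T \<Longrightarrow> zero_sum p n K x s \<Longrightarrow> s j1 = s j2"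
  shows "(card T)\<^sup>2 \<le> 10 * (card K)\<^sup>2 * p ^ n * card (low_degree p n (card K))"
proof -
  have finbox: "finite ({..<n} \<rightarrow>\<^sub>E {0..<int p})" by (intro finite_PiE) auto
  have cardT: "card T \<le> p ^ n"
    using card_inj_on_le[OF inj[OF K(2)] _ finbox] box[OF K(2)] card_box by (metis image_subsetI)
  define E where "E j = {(s j1, s j) |s. s \<in> K \<rightarrow>\<^sub>E T \<and> zero_sum p n K x s \<and> s j1 \<noteq> s j}" for j
  have E_sub: "E j \<subseteq> T \<times> T" if "j \<in> K" for j using that K by (auto simp: E_def)
  have cardE: "card (E j) \<le> p ^ n" if j: "j \<in> K - {j1}" for j
  proof -
    define \<phi> where "\<phi> = (\<lambda>(a, b). \<lambda>l\<in>{..<n}. (x j1 a l + x j b l) mod int p)"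
    have "inj_on \<phi> (E j)"
    proof (rule inj_onI)
      fix u v assume "u \<in> E j" and v: "v \<in> E j" and eq: "\<phi> u = \<phi> v"
      then obtain s where s: "u = (s j1, s j)" "s \<in> K \<rightarrow>\<^sub>E T" "zero_sum p n K x s" "s j1 \<noteq> s j"
        by (auto simp: E_def)
      obtain a b where ab: "v = (a, b)" by fastforce
      have abT: "a \<in> T" "b \<in> T" using v ab E_sub[of j] j by auto
      have eq': "[x j1 a l + x j b l = x j1 (s j1) l + x j (s j) l] (mod int p)" if "l < n" for l
        using fun_cong[OF eq, of l] that ab s by (simp add: \<phi>_def cong_def)
      have "zero_sum p n K x (s(j1 := a, j := b))"
        by (rule zero_sum_replace) (use K j s eq' in auto)
      moreover have "s(j1 := a, j := b) \<in> K \<rightarrow>\<^sub>E T"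
        using s(2) abT K j by (auto simp: PiE_iff extensional_def)
      \<comment> \<open>Since \<open>s\<close> agrees at \<open>j1\<close> and \<open>j2\<close> but
        not at \<open>j1\<close> and \<open>j\<close>, the exchange leaves position
        \<open>j2\<close> alone. The assumed coincidence then forces
        \<open>a = s j2 = s j1\<close>.\<close>
      moreover have "j \<noteq> j2" using s coinc by auto
      ultimately have "a = s j2" using coinc[of "s(j1 := a, j := b)"] K j by auto
      then have a: "a = s j1" using coinc[OF s(2,3)] by simp
      have sj: "s j \<in> T" using s(2) j by auto
      have "x j b = x j (s j)"
      proof (rule PiE_ext)
        show "x j b \<in> {..<n} \<rightarrow>\<^sub>E {0..<int p}" "x j (s j) \<in> {..<n} \<rightarrow>\<^sub>E {0..<int p}"
          using box j abT sj by auto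
        then show "x j b l = x j (s j) l" if "l \<in> {..<n}" for l
          using eq'[of l] that a by (auto simp: PiE_iff cong_add_lcancel intro!: cong_less_imp_eq_int)
      qed
      then have "b = s j" using inj[of j] j abT sj by (auto dest: inj_onD)
      then show "u = v" using a ab s by simp
    qed
    moreover have "\<phi> ` E j \<subseteq> {..<n} \<rightarrow>\<^sub>E {0..<int p}"
      using prime_gt_0_nat[OF p] by (auto simp: \<phi>_def split: if_splits)
    ultimately show ?thesis using card_inj_on_le[OF _ _ finbox] card_box by metis
  qed
  define F where "F = (\<Union>j\<in>K - {j1}. E j)"
  have F: "F \<subseteq> T \<times> T" using E_sub by (auto simp: F_def)
  have "card F \<le> (\<Sum>j\<in>K - {j1}. card (E j))" unfolding F_def using K by (intro card_UN_le) auto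
  also have "\<dots> \<le> (\<Sum>j\<in>K - {j1}. p ^ n)" using cardE by (intro sum_mono)
  also have "\<dots> \<le> card K * p ^ n" using K by (simp add: card_mono)
  finally have cardF: "card F \<le> card K * p ^ n" .
  obtain I where I: "I \<subseteq> T" "\<forall>a\<in>I. \<forall>b\<in>I. (a, b) \<in> F \<longrightarrow> a = b"
    "(card T)\<^sup>2 \<le> 2 * card I * (card T + 4 * card F)"
    by (rule independent_subset_exists[OF T F])
  have "{j1, j2} \<subseteq> K" using K by simp
  then have K2: "2 \<le> card K" using K by (metis card_2_iff card_mono)
  have free: "s j = s j'" if s: "s \<in> K \<rightarrow>\<^sub>E I" "zero_sum p n K x s" "j \<in> K" "j' \<in> K" for s j j'
  proof -
    have "s h = s j1" if h: "h \<in> K" for h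
    proof (rule ccontr)
      assume ne: "s h \<noteq> s j1"
      have "s \<in> K \<rightarrow>\<^sub>E T" using s I(1) by auto
      then have "(s j1, s h) \<in> F" using s(2) ne[symmetric] h unfolding F_def E_def by auto
      then show False using I(2) s(1) h K ne by (metis PiE_mem)
    qed
    then show ?thesis using s by metis
  qed
  have "card I \<le> card K * card (low_degree p n (card K))"
    using I(1) T diag by (intro multicolored_sum_free_card[OF p K(1) K2 _ _ free])
      (auto intro: finite_subset)
  \<comment> \<open>The factor 10 arises as \<open>2 * (1 + 4)\<close>, once \<open>card T\<close>
    is also bounded by \<open>card K * p ^ n\<close>.\<close>
  then have "2 * card I * (card T + 4 * card F) \<le>
      2 * (card K * card (low_degree p n (card K))) * (card K * p ^ n + 4 * (card K * p ^ n))"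
    using cardT cardF K2 by (intro mult_mono add_mono order.trans[OF cardT]) auto
  then show ?thesis using I(3) by (simp add: power2_eq_square algebra_simps)
qed

section \<open>Greedy choice of disjoint zero sums with a common pattern\<close>

text \<open>Take a maximal disjoint family of solutions with the largest permitted number of values.
  If it covers at least half of \<open>I\<close>, stop; otherwise delete what it covers, which
  lowers the permitted number by one. Each deletion loses less than half of the indices, hence the
  factor \<open>2 ^ m\<close>.\<close>

lemma disjoint_tuples_of_maximal_size:
  fixes sol :: "('j \<Rightarrow> 'a) \<Rightarrow> bool"
  assumes K: "finite K" "K \<noteq> {}" and I: "finite I"
    and diag: "\<And>i. i \<in> I \<Longrightarrow> sol (\<lambda>_\<in>K. i)"
    and bound: "\<And>s. s \<in> K \<rightarrow>\<^sub>E I \<Longrightarrow> sol s \<Longrightarrow> card (s ` K) \<le> m"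
  shows "\<exists>J\<subseteq>I. \<exists>m'\<le>m. \<exists>M\<subseteq>{s \<in> K \<rightarrow>\<^sub>E J. sol s \<and> card (s ` K) = m'}.
    pairwise (\<lambda>s t. disjnt (s ` K) (t ` K)) M \<and>
    (\<forall>s \<in> K \<rightarrow>\<^sub>E J. sol s \<longrightarrow> card (s ` K) \<le> m') \<and> card I \<le> 2 ^ m * m * card M"
  using I diag bound
proof (induction m arbitrary: I)
  case 0
  \<comment> \<open>A constant solution already has one value, against the bound 0.\<close>
  have "I = {}"
  proof (rule ccontr)
    assume "I \<noteq> {}"
    then obtain i where i: "i \<in> I" by auto
    then have "card ((\<lambda>_\<in>K. i) ` K) \<le> 0" by (intro "0.prems"(3,2)) auto
    then show False using K by simp
  qed
  then show ?case using K by (intro exI[of _ "{}"]) (auto simp: PiE_eq_empty_iff)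
next
  case (Suc m)
  define \<M> where "\<M> = {M. M \<subseteq> {s \<in> K \<rightarrow>\<^sub>E I. sol s \<and> card (s ` K) = Suc m} \<and>
    pairwise (\<lambda>s t. disjnt (s ` K) (t ` K)) M}"
  have fin: "finite (K \<rightarrow>\<^sub>E I)" using K Suc.prems(1) by (intro finite_PiE) auto
  then have "finite \<M>" by (intro finite_subset[of \<M> "Pow (K \<rightarrow>\<^sub>E I)"]) (auto simp: \<M>_def)
  moreover have "{} \<in> \<M>" by (simp add: \<M>_def)
  ultimately obtain M where M: "M \<in> \<M>" and max: "\<And>N. N \<in> \<M> \<Longrightarrow> M \<subseteq> N \<Longrightarrow> M = N"
    using finite_has_maximal[of \<M>] by auto
  have finM: "finite M" using M fin by (auto simp: \<M>_def intro: finite_subset)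
  define R where "R = (\<Union>s\<in>M. s ` K)"
  have "card R \<le> (\<Sum>s\<in>M. card (s ` K))" unfolding R_def using finM by (intro card_UN_le)
  also have "\<dots> = (\<Sum>s\<in>M. Suc m)" using M by (intro sum.cong) (auto simp: \<M>_def)
  finally have R: "card R \<le> Suc m * card M" by (simp add: mult.commute)
  have RI: "R \<subseteq> I" using M by (auto simp: R_def \<M>_def)
  show ?case
  proof (cases "card I \<le> 2 * card R")
    case True
    then have "card I \<le> 2 * (Suc m * card M)" using R by linarith
    also have "\<dots> = 2 ^ 1 * Suc m * card M" by simp
    also have "\<dots> \<le> 2 ^ Suc m * Suc m * card M"
      by (intro mult_right_mono power_increasing) auto
    finally have "card I \<le> 2 ^ Suc m * Suc m * card M" .
    then show ?thesis using M Suc.prems(3)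
      by (intro exI[of _ I] exI[of _ "Suc m"] exI[of _ M] conjI) (auto simp: \<M>_def)
  next
    case False
    \<comment> \<open>A solution with \<open>Suc m\<close> values outside \<open>R\<close> would be
      disjoint from the whole family and could be added to it.\<close>
    have "card (s ` K) \<le> m" if s: "s \<in> K \<rightarrow>\<^sub>E (I - R)" "sol s" for s
    proof (rule ccontr)
      assume "\<not> card (s ` K) \<le> m"
      moreover have sI: "s \<in> K \<rightarrow>\<^sub>E I" using s by auto
      ultimately have c: "card (s ` K) = Suc m" using Suc.prems(3) s(2) by (metis le_SucE)
      have dj: "disjnt (s ` K) (t ` K)" if "t \<in> M" for t
        using s(1) that by (auto simp: R_def disjnt_def)
      have "insert s M \<in> \<M>"
        using M sI s(2) c dj by (auto simp: \<M>_def pairwise_insert disjnt_sym)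
      then have "s \<in> M" using max by blast
      then show False using s(1) K by (fastforce simp: R_def)
    qed
    then have "\<exists>J\<subseteq>I - R. \<exists>m'\<le>m. \<exists>M\<subseteq>{s \<in> K \<rightarrow>\<^sub>E J. sol s \<and> card (s ` K) = m'}.
        pairwise (\<lambda>s t. disjnt (s ` K) (t ` K)) M \<and>
        (\<forall>s \<in> K \<rightarrow>\<^sub>E J. sol s \<longrightarrow> card (s ` K) \<le> m') \<and> card (I - R) \<le> 2 ^ m * m * card M"
      using Suc.prems(1,2) by (intro Suc.IH) auto
    then obtain J m' N where J: "J \<subseteq> I - R" "m' \<le> m"
      "N \<subseteq> {s \<in> K \<rightarrow>\<^sub>E J. sol s \<and> card (s ` K) = m'}" "pairwise (\<lambda>s t. disjnt (s ` K) (t ` K)) N"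
      "\<forall>s \<in> K \<rightarrow>\<^sub>E J. sol s \<longrightarrow> card (s ` K) \<le> m'" "card (I - R) \<le> 2 ^ m * m * card N"
      by (elim exE conjE) (rule that)
    have "card I \<le> 2 * card (I - R)"
      using False RI Suc.prems(1) by (simp add: card_Diff_subset finite_subset)
    also have "\<dots> \<le> 2 * (2 ^ m * m * card N)" using J(6) by simp
    also have "\<dots> \<le> 2 ^ Suc m * Suc m * card N" by simp
    finally show ?thesis using J
      by (intro exI[of _ J] exI[of _ m'] exI[of _ N] conjI) auto
  qed
qed

text \<open>\<open>N\<close> counts disjoint zero sums with the same pattern of coincidences. The
  greedy choice loses the factor \<open>2 ^ card K * card K\<close>, and fixing the pattern loses
  \<open>2 ^ (card K * card K)\<close>. Maximality of the number of values then provides the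
  coincidence that \<open>card_square_le_of_coincidence\<close> requires.\<close>

lemma card_le_of_no_injective_zero_sum:
  fixes x :: "'j \<Rightarrow> 'a \<Rightarrow> nat \<Rightarrow> int"
  assumes p: "prime p" and K: "finite K" "K \<noteq> {}" and I: "finite I"
    and box: "\<And>j i. j \<in> K \<Longrightarrow> i \<in> I \<Longrightarrow> x j i \<in> {..<n} \<rightarrow>\<^sub>E {0..<int p}"
    and inj: "\<And>j. j \<in> K \<Longrightarrow> inj_on (x j) I"
    and diag: "\<And>i. i \<in> I \<Longrightarrow> zero_sum p n K x (\<lambda>_\<in>K. i)"
    and no: "\<And>s. s \<in> K \<rightarrow>\<^sub>E I \<Longrightarrow> zero_sum p n K x s \<Longrightarrow> \<not> inj_on s K"
  obtains N where "card I \<le> 2 ^ card K * card K * 2 ^ (card K * card K) * N"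
    "N\<^sup>2 \<le> 10 * (card K)\<^sup>2 * p ^ n * card (low_degree p n (card K))"
proof -
  let ?k = "card K"
  have bound: "card (s ` K) \<le> ?k - 1" if "s \<in> K \<rightarrow>\<^sub>E I" "zero_sum p n K x s" for s
    using no[OF that] card_image_le[OF K(1), of s] eq_card_imp_inj_on[OF K(1), of s] by linarith
  obtain J m M where J: "J \<subseteq> I" and m: "m \<le> ?k - 1" and
    M: "M \<subseteq> {s \<in> K \<rightarrow>\<^sub>E J. zero_sum p n K x s \<and> card (s ` K) = m}" and
    disj: "pairwise (\<lambda>s t. disjnt (s ` K) (t ` K)) M" and
    max: "\<And>s. s \<in> K \<rightarrow>\<^sub>E J \<Longrightarrow> zero_sum p n K x s \<Longrightarrow> card (s ` K) \<le> m" and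
    cI: "card I \<le> 2 ^ (?k - 1) * (?k - 1) * card M"
    using disjoint_tuples_of_maximal_size[of K I "zero_sum p n K x" "?k - 1", OF K I diag bound]
    by blast
  have "finite (K \<rightarrow>\<^sub>E J)" using K I J by (auto intro: finite_PiE finite_subset)
  then have finM: "finite M" using M by (auto intro: finite_subset)
  have k: "?k \<ge> 1" using K by (simp add: Suc_le_eq card_gt_0_iff)
  \<comment> \<open>A pattern is the equality relation between entries, encoded as a subset of
    \<open>K \<times> K\<close>.\<close>
  define pattern where "pattern t = {(j, j') \<in> K \<times> K. t j = t j'}" for t :: "'j \<Rightarrow> 'a"
  have "\<exists>r\<in>Pow (K \<times> K). card M \<le> card (pattern -` {r} \<inter> M) * card (Pow (K \<times> K))"
    using K finM by (intro pigeonhole_card) (auto simp: pattern_def)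
  then obtain r where r: "card M \<le> card (pattern -` {r} \<inter> M) * 2 ^ (?k * ?k)"
    using K by (auto simp: card_Pow card_cartesian_product)
  define T where "T = pattern -` {r} \<inter> M"
  have TM: "T \<subseteq> M" "finite T" using finM by (auto simp: T_def)
  have TJ: "t j \<in> J" if "t \<in> T" "j \<in> K" for t j using that TM M by auto
  have same: "t j = t j' \<longleftrightarrow> t' j = t' j'" if "t \<in> T" "t' \<in> T" "j \<in> K" "j' \<in> K" for t t' j j'
  proof -
    have "pattern t = pattern t'" using that by (auto simp: T_def)
    then have "(j, j') \<in> pattern t \<longleftrightarrow> (j, j') \<in> pattern t'" by simp
    then show ?thesis using that by (simp add: pattern_def)
  qed
  \<comment> \<open>By disjointness a single shared value identifies the whole tuple, even when it
    occurs at different positions.\<close>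
  have sep: "t = t'" if "t \<in> T" "t' \<in> T" "j \<in> K" "j' \<in> K" "t j = t' j'" for t t' j j'
    using pairwiseD[OF disj, of t t'] that TM by (auto simp: disjnt_iff)
  have "2 ^ (?k - 1) * (?k - 1) * card M \<le> 2 ^ ?k * ?k * card M"
    by (intro mult_mono) (auto intro: power_increasing)
  also have "\<dots> \<le> 2 ^ ?k * ?k * (card T * 2 ^ (?k * ?k))"
    using r by (intro mult_left_mono) (auto simp: T_def)
  finally have card1: "card I \<le> 2 ^ ?k * ?k * 2 ^ (?k * ?k) * card T" using cI by (simp add: mult_ac)
  have "(card T)\<^sup>2 \<le> 10 * ?k\<^sup>2 * p ^ n * card (low_degree p n ?k)"
  proof (cases "T = {}")
    case False
    then obtain t0 where t0: "t0 \<in> T" by auto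
    have "card (t0 ` K) = m" using t0 TM M by auto
    \<comment> \<open>At most \<open>card K - 1\<close> values fill \<open>card K\<close> positions,
      so the common pattern identifies two of them.\<close>
    then have "\<not> inj_on t0 K" using m k card_image[of t0 K] by auto
    then obtain j1 j2 where j: "j1 \<in> K" "j2 \<in> K" "j1 \<noteq> j2" "t0 j1 = t0 j2" by (auto simp: inj_on_def)
    \<comment> \<open>Each zero sum in \<open>T\<close> becomes a single index, from which colour
      \<open>j\<close> reads the entry at position \<open>j\<close>.\<close>
    define y where "y = (\<lambda>j t. x j (t j))"
    show ?thesis
    proof (rule card_square_le_of_coincidence[where x = y])
      show "y h t \<in> {..<n} \<rightarrow>\<^sub>E {0..<int p}" if "h \<in> K" "t \<in> T" for h t
        using that TJ J box unfolding y_def by blast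
      show "inj_on (y h) T" if h: "h \<in> K" for h
      proof (rule inj_onI)
        fix t t' assume t: "t \<in> T" "t' \<in> T" "y h t = y h t'"
        then have "t h = t' h" using inj_onD[OF inj[OF h]] TJ J h unfolding y_def by blast
        then show "t = t'" using sep t h by blast
      qed
      show "zero_sum p n K y (\<lambda>_\<in>K. t)" if t: "t \<in> T" for t
        using subsetD[OF M subsetD[OF TM(1) t]] by (simp add: zero_sum_def y_def)
      show "s j1 = s j2" if s: "s \<in> K \<rightarrow>\<^sub>E T" "zero_sum p n K y s" for s
      proof -
        \<comment> \<open>A diagonal choice: position \<open>h\<close> takes the entry at
          \<open>h\<close> of the tuple \<open>s h\<close>. It turns a zero sum for \<open>y\<close>
          into one for \<open>x\<close> over \<open>J\<close>, where maximality of \<open>m\<close>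
          applies.\<close>
        define u where "u = (\<lambda>h\<in>K. s h h)"
        have sT: "s h \<in> T" if "h \<in> K" for h using s(1) that by auto
        have "u \<in> K \<rightarrow>\<^sub>E J" using sT TJ by (auto simp: u_def)
        moreover have "zero_sum p n K x u" using s(2) by (simp add: zero_sum_def y_def u_def)
        ultimately have um: "card (u ` K) \<le> m" by (rule max)
        \<comment> \<open>The pattern of \<open>u\<close> refines the common pattern of \<open>T\<close>, and maximality of \<open>m\<close> forces
          equality.\<close>
        have uw: "t0 h = t0 h'" if h: "h \<in> K" "h' \<in> K" "u h = u h'" for h h'
        proof -
          have "s h h = s h' h'" using h by (simp add: u_def)
          then have "s h = s h'" using sep[OF sT sT] h by blast
          then have "s h h = s h h'" using h by (simp add: u_def)
          then show ?thesis using same[OF sT[OF h(1)] t0] h by blast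
        qed
        \<comment> \<open>By \<open>uw\<close>, \<open>g\<close> is well defined from the values of
          \<open>u\<close> to those of \<open>t0\<close>. It maps at most \<open>m\<close> values
          onto \<open>m\<close>, so it is injective, and \<open>t0 j1 = t0 j2\<close> gives
          \<open>u j1 = u j2\<close>.\<close>
        define g where "g v = t0 (SOME h. h \<in> K \<and> u h = v)" for v
        have g: "g (u h) = t0 h" if h: "h \<in> K" for h
        proof -
          have "\<exists>h'. h' \<in> K \<and> u h' = u h" using h by auto
          from someI_ex[OF this] show ?thesis unfolding g_def using uw h by blast
        qed
        have gu: "g ` u ` K = t0 ` K" using g by (auto simp: image_image)
        have "card (g ` u ` K) = card (u ` K)"
          using um \<open>card (t0 ` K) = m\<close> gu card_image_le[of "u ` K" g] K by simp
        then have "inj_on g (u ` K)" using K by (intro eq_card_imp_inj_on) auto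
        then have "u j1 = u j2" using g j by (metis imageI inj_onD)
        then have "s j1 j1 = s j2 j2" using j by (simp add: u_def)
        then show ?thesis using sep[OF sT sT] j by blast
      qed
    qed (use p K j TM in auto)
  qed simp
  with card1 that show thesis by blast
qed

section \<open>The group \<open>\<F>\<^sub>p\<^sup>n\<close>\<close>

text \<open>By induction on \<open>K\<close>, the group product is the coordinatewise integer sum
  reduced modulo \<open>p\<close>.\<close>

lemma finprod_Fp_space_eq_one_iff:
  assumes p: "prime p" and K: "finite K" and f: "\<And>j. j \<in> K \<Longrightarrow> f j \<in> carrier (Fp_space p n)"
  shows "(\<Otimes>\<^bsub>Fp_space p n\<^esub>j\<in>K. f j) = \<one>\<^bsub>Fp_space p n\<^esub> \<longleftrightarrow> (\<forall>l<n. int p dvd (\<Sum>j\<in>K. f j l))"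
proof -
  interpret G: comm_group "Fp_space p n" by (rule Fp_space_comm_group[OF p])
  have "(\<Otimes>\<^bsub>Fp_space p n\<^esub>j\<in>K. f j) = (\<lambda>l\<in>{..<n}. (\<Sum>j\<in>K. f j l) mod int p)"
    using K f
  proof (induction K)
    case empty
    have "\<one>\<^bsub>Fp_space p n\<^esub> = (\<lambda>l\<in>{..<n}. 0)" by (simp add: Fp_space_def residue_ring_def)
    then show ?case by simp
  next
    case (insert j K)
    then have "(\<Otimes>\<^bsub>Fp_space p n\<^esub>h\<in>insert j K. f h) = f j \<otimes>\<^bsub>Fp_space p n\<^esub> (\<Otimes>\<^bsub>Fp_space p n\<^esub>h\<in>K. f h)"
      by (intro G.finprod_insert) auto
    also have "\<dots> = (\<lambda>l\<in>{..<n}. (\<Sum>h\<in>insert j K. f h l) mod int p)"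
      using insert by (simp add: Fp_space_def residue_ring_def mod_add_right_eq cong: restrict_cong)
    finally show ?case .
  qed
  moreover have "\<one>\<^bsub>Fp_space p n\<^esub> = (\<lambda>l\<in>{..<n}. 0)"
    by (simp add: Fp_space_def residue_ring_def)
  ultimately show ?thesis by (auto simp: fun_eq_iff dvd_eq_mod_eq_0)
qed

lemma carrier_Fp_space: "carrier (Fp_space p n) = ({..<n} \<rightarrow>\<^sub>E {0..<int p})"
proof -
  have "{0..int p - 1} = {0..<int p}" by auto
  then show ?thesis by (simp add: Fp_space_def residue_ring_def)
qed

theorem theorem5p1:
  fixes k :: nat
  assumes "k \<ge> 3"
  shows "\<exists>C :: real. \<forall>(p :: nat) (n :: nat) (L :: nat) (x :: nat \<Rightarrow> nat \<Rightarrow> nat \<Rightarrow> int).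
    prime p \<longrightarrow> p \<ge> 5 \<longrightarrow> n \<ge> 1 \<longrightarrow>
    (\<forall>j\<in>{1..k}. \<forall>i\<in>{1..L}. x j i \<in> carrier (Fp_space p n)) \<longrightarrow>
    (\<forall>j\<in>{1..k}. inj_on (x j) {1..L}) \<longrightarrow>
    (\<forall>i\<in>{1..L}. (\<Otimes>\<^bsub>Fp_space p n\<^esub>j\<in>{1..k}. x j i) = \<one>\<^bsub>Fp_space p n\<^esub>) \<longrightarrow>
    \<not> (\<exists>\<iota>. (\<forall>j\<in>{1..k}. \<iota> j \<in> {1..L}) \<and> inj_on \<iota> {1..k} \<and>
        (\<Otimes>\<^bsub>Fp_space p n\<^esub>j\<in>{1..k}. x j (\<iota> j)) = \<one>\<^bsub>Fp_space p n\<^esub>) \<longrightarrow>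
    real L \<le> C * (sqrt (Gamma_min p k * real p)) ^ n"
proof -
  \<comment> \<open>The combined loss of the greedy choice and of fixing a pattern; the remaining
    factor of the constant comes from the quadratic bound on \<open>N\<close>.\<close>
  define c :: nat where "c = 2 ^ k * k * 2 ^ (k * k)"
  show ?thesis
  proof (intro exI[of _ "real c * sqrt (10 * (real k)\<^sup>2)"] allI impI)
    fix p n L :: nat and x :: "nat \<Rightarrow> nat \<Rightarrow> nat \<Rightarrow> int"
    assume p: "prime p" and carr: "\<forall>j\<in>{1..k}. \<forall>i\<in>{1..L}. x j i \<in> carrier (Fp_space p n)"
      and inj: "\<forall>j\<in>{1..k}. inj_on (x j) {1..L}"
      and diag: "\<forall>i\<in>{1..L}. (\<Otimes>\<^bsub>Fp_space p n\<^esub>j\<in>{1..k}. x j i) = \<one>\<^bsub>Fp_space p n\<^esub>"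
      and no: "\<not> (\<exists>\<iota>. (\<forall>j\<in>{1..k}. \<iota> j \<in> {1..L}) \<and> inj_on \<iota> {1..k} \<and>
        (\<Otimes>\<^bsub>Fp_space p n\<^esub>j\<in>{1..k}. x j (\<iota> j)) = \<one>\<^bsub>Fp_space p n\<^esub>)"
    have zs: "zero_sum p n {1..k} x s \<longleftrightarrow>
        (\<Otimes>\<^bsub>Fp_space p n\<^esub>j\<in>{1..k}. x j (s j)) = \<one>\<^bsub>Fp_space p n\<^esub>"
      if "\<And>j. j \<in> {1..k} \<Longrightarrow> s j \<in> {1..L}" for s
      unfolding zero_sum_def using p carr that
      by (intro finprod_Fp_space_eq_one_iff[symmetric]) auto
    have box: "x j i \<in> {..<n} \<rightarrow>\<^sub>E {0..<int p}" if "j \<in> {1..k}" "i \<in> {1..L}" for j i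
      using carr that by (simp add: carrier_Fp_space)
    have dg: "zero_sum p n {1..k} x (\<lambda>_\<in>{1..k}. i)" if "i \<in> {1..L}" for i
      using zs[of "\<lambda>_. i"] diag that by (simp add: zero_sum_def)
    have ni: "\<not> inj_on s {1..k}" if "s \<in> {1..k} \<rightarrow>\<^sub>E {1..L}" "zero_sum p n {1..k} x s" for s
      using zs[of s] no that by (metis PiE_mem)
    have ne: "{1..k} \<noteq> {}" using assms by auto
    obtain N where N: "card {1..L} \<le> 2 ^ card {1..k} * card {1..k} * 2 ^ (card {1..k} * card {1..k}) * N"
      "N\<^sup>2 \<le> 10 * (card {1..k})\<^sup>2 * p ^ n * card (low_degree p n (card {1..k}))"
      by (rule card_le_of_no_injective_zero_sum[OF p finite_atLeastAtMost ne finite_atLeastAtMost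
            box inj[rule_format] dg ni])
    have L: "L \<le> c * N" and N2: "N\<^sup>2 \<le> 10 * k\<^sup>2 * p ^ n * card (low_degree p n k)"
      using N by (simp_all add: c_def)
    have p2: "p \<ge> 2" by (rule prime_ge_2_nat[OF p])
    \<comment> \<open>The count of low-degree monomials is bounded for every \<open>t\<close>; the
      minimizing one yields \<open>Gamma_min p k\<close>.\<close>
    obtain t where t: "0 < t" "t < 1" "Gamma_min p k = Gamma_fun p k t"
      by (rule Gamma_min_attained[OF p2 assms])
    have low: "real (card (low_degree p n k)) \<le> Gamma_min p k ^ n"
      using card_low_degree_le[OF t(1,2), of k p n] assms p2 t(3) by simp
    have "(real N)\<^sup>2 \<le> real (10 * k\<^sup>2 * p ^ n * card (low_degree p n k))"
      using N2 by (metis of_nat_le_iff of_nat_power)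
    also have "\<dots> = 10 * (real k)\<^sup>2 * real p ^ n * real (card (low_degree p n k))" by simp
    also have "\<dots> \<le> 10 * (real k)\<^sup>2 * real p ^ n * Gamma_min p k ^ n"
      using low by (intro mult_left_mono) auto
    also have "\<dots> = 10 * (real k)\<^sup>2 * (Gamma_min p k * real p) ^ n" by (simp add: power_mult_distrib)
    \<comment> \<open>The independent-set argument bounds only the square of \<open>N\<close>; this
      is the origin of the square root in the final bound.\<close>
    finally have "real N \<le> sqrt (10 * (real k)\<^sup>2 * (Gamma_min p k * real p) ^ n)"
      by (rule real_le_rsqrt)
    also have "\<dots> = sqrt (10 * (real k)\<^sup>2) * sqrt (Gamma_min p k * real p) ^ n"
      by (simp only: real_sqrt_mult real_sqrt_power)
    finally have "real c * real N \<le> real c * (sqrt (10 * (real k)\<^sup>2) * sqrt (Gamma_min p k * real p) ^ n)"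
      by (rule mult_left_mono) simp
    moreover have "real L \<le> real c * real N" using L by (metis of_nat_le_iff of_nat_mult)
    ultimately show "real L \<le> real c * sqrt (10 * (real k)\<^sup>2) * sqrt (Gamma_min p k * real p) ^ n"
      by (simp add: mult.assoc)
  qed
qed

end
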